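(* There is a universal constant $C>0$ such that the following holds. Let $\theta:\mathbb{R}\to\mathbb{R}$ be a $C^1$ smooth solution of the stationary problem $$H\theta\,\partial_x\theta=f\quad\text{on }\mathbb{R},$$ where $0\le f\in L^\infty(\mathbb{R})$. If $\theta$ is even, monotone decreasing away from the origin (i.e. on $(0,\infty)$), and non-negative, then $$|\theta(x_1)-\theta(x_2)|\le C\,\|f\|_{L^\infty}^{1/2}\,|x_1-x_2|^{1/2}$$ for all $x_1\ne x_2\in\mathbb{R}$.
   Context: $H$ is the Hilbert transform $H\theta(x)=\frac1\pi\,\mathrm{p.v.}\int_{\mathbb{R}}\frac{\theta(y)}{y-x}\,dy$; for even $\theta$, $H\theta(x)=\frac{2x}{\pi}\int_0^\infty\frac{\theta(y)-\theta(x)}{y^2-x^2}\,dy$. *)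

theory Defs
  imports "HOL-Analysis.Analysis" "HOL-Probability.Essential_Supremum"
begin

text \<open>
  The principal value is symmetric both at the singularity and at infinity. The latter matters:
  the functions of interest are merely bounded and need not decay, so the integral over
  \<open>\<bar>y - x\<bar> > \<epsilon>\<close> need not converge absolutely. For a bounded, even \<open>C\<^sup>1\<close> function the joint limit
  exists at every point and equals \<open>(2*x/pi)\<close> times the integral of
  \<open>(\<theta> y - \<theta> x) / (y\<^sup>2 - x\<^sup>2)\<close> over \<open>(0,\<infinity>)\<close>. Note the kernel \<open>1/(y - x)\<close> rather than \<open>1/(x - y)\<close>.
\<close>
definition hilbert_transform :: "(real \<Rightarrow> real) \<Rightarrow> real \<Rightarrow> real" where
  "hilbert_transform \<theta> x =
     (1 / pi) * Lim (at_right 0 \<times>\<^sub>F at_top)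
       (\<lambda>(\<epsilon>, R). LINT y:{y. \<epsilon> < \<bar>y - x\<bar> \<and> \<bar>y - x\<bar> < R}|lebesgue. \<theta> y / (y - x))"

definition Linf :: "(real \<Rightarrow> real) set" where
  "Linf = {f \<in> borel_measurable lebesgue. esssup lebesgue (\<lambda>x. ereal \<bar>f x\<bar>) < \<infinity>}"

text \<open>On \<open>Linf\<close> the essential supremum is finite, so the conversion to a real number is exact there.\<close>
definition Linf_norm :: "(real \<Rightarrow> real) \<Rightarrow> real" where
  "Linf_norm f = real_of_ereal (esssup lebesgue (\<lambda>x. ereal \<bar>f x\<bar>))"

text \<open>Elements of \<open>Linf\<close> are understood modulo null sets, so the equation is required almost everywhere.\<close>
definition stationary_solution :: "(real \<Rightarrow> real) \<Rightarrow> (real \<Rightarrow> real) \<Rightarrow> bool" where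
  "stationary_solution \<theta> f \<longleftrightarrow>
     \<theta> C1_differentiable_on UNIV \<and>
     (AE x in lebesgue. hilbert_transform \<theta> x * deriv \<theta> x = f x)"

end

theory Submission imports Defs begin

text \<open>
  For \<open>x > 0\<close> put \<open>\<phi> t = (\<theta> (x - t) - \<theta> (x + t)) / t\<close>. Evenness and monotonicity give \<open>\<phi> \<ge> 0\<close>, and the
  truncated principal value is minus the integral of \<open>\<phi>\<close> over \<open>[\<epsilon>, R]\<close>; hence the double limit exists
  and every such integral is a lower bound for \<open>- pi * hilbert_transform \<theta> x\<close>. Let
  \<open>h = x2 - x1 \<le> x1\<close> and let \<open>d\<close> be the drop of \<open>\<theta>\<close> from \<open>x1\<close> to \<open>x2\<close>. For \<open>x\<close> in between and
  \<open>h \<le> t \<le> 2 * h\<close> the numerator of \<open>\<phi> t\<close> is at least \<open>d\<close>, so \<open>- hilbert_transform \<theta> x \<ge> d / (2 * pi)\<close>.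
  The equation then bounds the slope by \<open>2 * pi * M / d\<close>, where \<open>M\<close> is the norm of \<open>f\<close>, and the mean
  value theorem gives \<open>d\<^sup>2 \<le> 2 * pi * M * h\<close>. Intervals with \<open>x1 < h\<close> are contained in
  \<open>[0, 2 * h]\<close>, on which the estimate is summed over dyadic pieces.
\<close>

section \<open>Truncated principal values and their joint limit\<close>

text \<open>Both halves of the truncated region are folded onto
  \<open>t = \<bar>y - x\<bar>\<close>: substituting \<open>y = x + t\<close> turns the kernel into
  \<open>1 / t\<close>, substituting \<open>y = x - t\<close> turns it into
  \<open>- 1 / t\<close>.\<close>

lemma truncated_hilbert_eq_integral:
  fixes g :: "real \<Rightarrow> real"
  assumes g: "continuous_on UNIV g" and e: "0 < e" "e < R"
  shows "(LINT y:{y. e < \<bar>y - x\<bar> \<and> \<bar>y - x\<bar> < R}|lebesgue. g y / (y - x))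
    = - integral {e..R} (\<lambda>t. (g (x - t) - g (x + t)) / t)"
proof -
  define k where "k = (\<lambda>y. g y / (y - x))"
  have set_eq: "{y. e < \<bar>y - x\<bar> \<and> \<bar>y - x\<bar> < R} = {x - R<..<x - e} \<union> {x + e<..<x + R}"
    using e by auto
  have cont: "continuous_on {a..b} k" if "x \<notin> {a..b}" for a b
    unfolding k_def using that
    by (intro continuous_intros continuous_on_subset[OF g]) auto
  have c1: "continuous_on {x - R..x - e} k" and c2: "continuous_on {x + e..x + R} k"
    using e by (auto intro!: cont)
  have i1: "set_integrable lebesgue {x - R<..<x - e} k"
    using absolutely_integrable_continuous_real[OF c1]
      absolutely_integrable_on_open_interval[where f = k and a = "x - R" and b = "x - e"] by simp
  have i2: "set_integrable lebesgue {x + e<..<x + R} k"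
    using absolutely_integrable_continuous_real[OF c2]
      absolutely_integrable_on_open_interval[where f = k and a = "x + e" and b = "x + R"] by simp
  have "(LINT y:{y. e < \<bar>y - x\<bar> \<and> \<bar>y - x\<bar> < R}|lebesgue. k y)
    = integral {x - R..x - e} k + integral {x + e..x + R} k"
    unfolding set_eq using e
    by (subst set_integral_Un[OF _ i1 i2])
      (auto simp: set_lebesgue_integral_eq_integral(2)[OF i1]
        set_lebesgue_integral_eq_integral(2)[OF i2] integral_open_interval_real)
  also have "integral {x + e..x + R} k = integral {e..R} (\<lambda>t. g (x + t) / t)"
    using integral_shift_Icc_real[of e R k x] by (simp add: k_def o_def add.commute)
  also have "integral {x - R..x - e} k = integral {-R..-e} (\<lambda>t. g (x + t) / t)"
    using integral_shift_Icc_real[of "-R" "-e" k x] by (simp add: k_def o_def)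
  also have "\<dots> = integral {e..R} (\<lambda>t. - (g (x - t) / t))"
    using Henstock_Kurzweil_Integration.integral_reflect_real[of R e "\<lambda>t. - (g (x - t) / t)"] by simp
  also have "\<dots> + integral {e..R} (\<lambda>t. g (x + t) / t)
    = integral {e..R} (\<lambda>t. - (g (x - t) / t) + g (x + t) / t)"
    using e by (intro Henstock_Kurzweil_Integration.integral_add[symmetric] integrable_continuous_interval
      continuous_intros continuous_on_compose2[OF g]) auto
  also have "\<dots> = integral {e..R} (\<lambda>t. - ((g (x - t) - g (x + t)) / t))"
    by (rule arg_cong[where f = "integral _"]) (auto simp: diff_divide_distrib)
  finally show ?thesis
    by (simp add: k_def)
qed

text \<open>For a nonnegative integrand the integral grows when \<open>e\<close> decreases or
  \<open>R\<close> increases, so the joint limit is the supremum over all truncations. This supplies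
  both existence of the limit and the lower bounds for it.\<close>

lemma truncated_integral_tendsto:
  fixes \<phi> :: "real \<Rightarrow> real"
  assumes int: "\<And>e R. 0 < e \<Longrightarrow> \<phi> integrable_on {e..R}"
    and nonneg: "\<And>t. 0 < t \<Longrightarrow> 0 \<le> \<phi> t"
    and bound: "\<And>e R. 0 < e \<Longrightarrow> e < 1 \<Longrightarrow> 1 < R \<Longrightarrow> integral {e..R} \<phi> \<le> B"
  obtains L where "((\<lambda>(e, R). integral {e..R} \<phi>) \<longlongrightarrow> L) (at_right 0 \<times>\<^sub>F at_top)"
    and "\<And>e R. 0 < e \<Longrightarrow> integral {e..R} \<phi> \<le> L"
proof -
  define J where "J = (\<lambda>e R. integral {e..R} \<phi>)"
  define A where "A = (\<lambda>(e, R). J e R) ` ({0<..} \<times> UNIV)"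
  have mono: "J e R \<le> J e' R'" if "0 < e'" "e' \<le> e" "R \<le> R'" for e e' R R'
    unfolding J_def using that
    by (intro integral_subset_le int) (auto intro!: nonneg)
  have le_B: "J e R \<le> B" if "0 < e" for e R
  proof -
    \<comment> \<open>The interval is enlarged until \<open>e < 1 < R\<close>, the range in which
      \<open>bound\<close> is available.\<close>
    have "J e R \<le> J (min e (1/2)) (max R 2)"
      using that by (intro mono) auto
    also have "\<dots> \<le> B"
      unfolding J_def using that by (intro bound) auto
    finally show ?thesis .
  qed
  have bdd: "bdd_above A"
    unfolding A_def by (rule bdd_aboveI[of _ B]) (auto intro: le_B)
  have le_Sup: "J e R \<le> Sup A" if "0 < e" for e R
    using that by (intro cSup_upper[OF _ bdd]) (auto simp: A_def)
  have "((\<lambda>(e, R). J e R) \<longlongrightarrow> Sup A) (at_right 0 \<times>\<^sub>F at_top)"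
  proof (rule order_tendstoI)
    fix a assume "a < Sup A"
    moreover have "A \<noteq> {}"
      by (auto simp: A_def)
    ultimately obtain e0 R0 where *: "0 < e0" "a < J e0 R0"
      using less_cSup_iff[OF _ bdd] by (auto simp: A_def)
    have "a < J e R" if "0 < e \<and> e < e0" "R0 \<le> R" for e R
      using mono[of e e0 R0 R] that * by auto
    moreover have "\<forall>\<^sub>F e in at_right 0. 0 < e \<and> e < e0"
      using *(1) by (auto simp: eventually_at_right_field)
    moreover have "\<forall>\<^sub>F R in at_top. R0 \<le> R"
      by (rule eventually_ge_at_top)
    ultimately show "\<forall>\<^sub>F p in at_right 0 \<times>\<^sub>F at_top. a < (case p of (e, R) \<Rightarrow> J e R)"
      unfolding eventually_prod_filter by (metis (mono_tags, lifting) case_prod_conv)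
  next
    fix a assume "Sup A < a"
    then have "J e R < a" if "0 < e" for e R
      using le_Sup[OF that, of R] by simp
    moreover have "\<forall>\<^sub>F e::real in at_right 0. 0 < e"
      by (simp add: eventually_at_right_less)
    moreover have "\<forall>\<^sub>F R::real in at_top. True"
      by simp
    ultimately show "\<forall>\<^sub>F p in at_right 0 \<times>\<^sub>F at_top. (case p of (e, R) \<Rightarrow> J e R) < a"
      unfolding eventually_prod_filter by (metis (mono_tags, lifting) case_prod_conv)
  qed
  with le_Sup show thesis
    by (intro that[of "Sup A"]) (auto simp: J_def)
qed

text \<open>The integral is split at \<open>t = 1\<close>. Near the singularity the symmetric
  difference quotient is controlled by \<open>\<theta>'\<close> on a compact interval. Far away the
  integrand is at most a difference of two translates of \<open>\<theta>\<close>, whose integrals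
  cancel except over two windows of length \<open>2 * x\<close>.\<close>

lemma truncated_hilbert_bounded:
  fixes \<theta> \<theta>' :: "real \<Rightarrow> real"
  assumes der: "\<And>x. (\<theta> has_real_derivative \<theta>' x) (at x)"
    and cont': "continuous_on UNIV \<theta>'"
    and anti: "\<And>a b. \<bar>a\<bar> \<le> \<bar>b\<bar> \<Longrightarrow> \<theta> b \<le> \<theta> a"
    and nonneg: "\<And>x. 0 \<le> \<theta> x"
    and x: "0 < x"
  obtains B where "\<And>e R. 0 < e \<Longrightarrow> e < 1 \<Longrightarrow> 1 < R \<Longrightarrow>
    integral {e..R} (\<lambda>t. (\<theta> (x - t) - \<theta> (x + t)) / t) \<le> B"
proof -
  define \<phi> where "\<phi> = (\<lambda>t. (\<theta> (x - t) - \<theta> (x + t)) / t)"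
  have cont: "continuous_on UNIV \<theta>"
    using der by (meson DERIV_isCont continuous_at_imp_continuous_on)
  have int\<theta>: "\<theta> integrable_on {a..b}" for a b
    by (intro integrable_continuous_interval continuous_on_subset[OF cont]) auto
  have int\<phi>: "\<phi> integrable_on {e..R}" if "0 < e" for e R
    unfolding \<phi>_def using that
    by (intro integrable_continuous_interval continuous_intros continuous_on_compose2[OF cont]) auto
  have "compact (\<theta>' ` {x - 1..x + 1})"
    by (intro compact_continuous_image continuous_on_subset[OF cont']) auto
  then obtain K where K: "\<And>y. y \<in> {x - 1..x + 1} \<Longrightarrow> \<bar>\<theta>' y\<bar> \<le> K"
    by (metis bounded_iff compact_imp_bounded imageI real_norm_def)
  have "K \<ge> 0"
    using K[of x] by auto
  have near: "\<phi> t \<le> 2 * K" if "0 < t" "t \<le> 1" for t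
  proof -
    have "\<exists>z. z > x - t \<and> z < x + t \<and> \<theta> (x + t) - \<theta> (x - t) = (x + t - (x - t)) * \<theta>' z"
      using that by (intro MVT2 der) auto
    then obtain z where z: "x - t < z" "z < x + t" "\<theta> (x + t) - \<theta> (x - t) = 2 * t * \<theta>' z"
      by auto
    have "\<phi> t = 2 * - \<theta>' z"
      using z(3) that by (simp add: \<phi>_def field_simps)
    also have "\<dots> \<le> 2 * K"
      using K[of z] z(1,2) that by auto
    finally show ?thesis .
  qed
  \<comment> \<open>The term \<open>2 * K\<close> bounds the part over \<open>{e..1}\<close>;
    \<open>2 * x * \<theta> 0\<close> bounds the window of length \<open>2 * x\<close> around 1,
    where \<open>\<theta> \<le> \<theta> 0\<close>.\<close>
  have "integral {e..R} \<phi> \<le> 2 * K + 2 * x * \<theta> 0" if e: "0 < e" "e < 1" "1 < R" for e R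
  proof -
    have "integral {e..R} \<phi> = integral {e..1} \<phi> + integral {1..R} \<phi>"
      using e by (intro Henstock_Kurzweil_Integration.integral_combine[symmetric] int\<phi>) auto
    moreover have "integral {e..1} \<phi> \<le> 2 * K"
    proof -
      have "integral {e..1} \<phi> \<le> integral {e..1} (\<lambda>t. 2 * K)"
        using e by (intro integral_le int\<phi>) (auto intro: near)
      also have "\<dots> = (1 - e) * (2 * K)"
        using e by simp
      also have "\<dots> \<le> 2 * K"
        using e \<open>K \<ge> 0\<close> by (intro mult_left_le_one_le) auto
      finally show ?thesis .
    qed
    moreover have "integral {1..R} \<phi> \<le> integral {1..R} (\<lambda>t. \<theta> (t + - x) - \<theta> (t + x))"
    proof (intro integral_le int\<phi>)
      show "(\<lambda>t. \<theta> (t + - x) - \<theta> (t + x)) integrable_on {1..R}"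
        by (intro integrable_continuous_interval continuous_intros continuous_on_compose2[OF cont]) auto
      show "\<phi> t \<le> \<theta> (t + - x) - \<theta> (t + x)" if "t \<in> {1..R}" for t
      proof -
        \<comment> \<open>Evenness is contained in \<open>anti\<close>: arguments of equal absolute
          value can be compared in both directions.\<close>
        have "\<theta> (t + - x) = \<theta> (x - t)"
          using anti[of "t + - x" "x - t"] anti[of "x - t" "t + - x"] by linarith
        moreover have "\<theta> (x + t) \<le> \<theta> (x - t)"
          using x that by (intro anti) auto
        ultimately show ?thesis
          using that by (simp add: \<phi>_def add.commute divide_le_eq mult_left_le mult_le_cancel_left1)
      qed
    qed simp
    moreover have "integral {1..R} (\<lambda>t. \<theta> (t + - x) - \<theta> (t + x))
        = integral {1..R} (\<lambda>t. \<theta> (t + - x)) - integral {1..R} (\<lambda>t. \<theta> (t + x))"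
      by (intro Henstock_Kurzweil_Integration.integral_diff integrable_continuous_interval
        continuous_intros continuous_on_compose2[OF cont]) auto
    moreover have "integral {1..R} (\<lambda>t. \<theta> (t + - x)) = integral {1 - x..R - x} \<theta>"
      using integral_shift_Icc_real[of 1 R \<theta> "- x"] by (simp add: o_def add.commute)
    moreover have "integral {1..R} (\<lambda>t. \<theta> (t + x)) = integral {1 + x..R + x} \<theta>"
      using integral_shift_Icc_real[of 1 R \<theta> x] by (simp add: o_def add.commute)
    \<comment> \<open>Splitting \<open>{1 - x..R + x}\<close> in two ways rewrites the difference of
      the translates as the integral over \<open>{1 - x..1 + x}\<close> minus the one over
      \<open>{R - x..R + x}\<close>; the latter is nonnegative and is dropped.\<close>
    moreover have "integral {1 - x..R - x} \<theta> + integral {R - x..R + x} \<theta> = integral {1 - x..R + x} \<theta>"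
      using e x by (intro Henstock_Kurzweil_Integration.integral_combine int\<theta>) auto
    moreover have "integral {1 - x..1 + x} \<theta> + integral {1 + x..R + x} \<theta> = integral {1 - x..R + x} \<theta>"
      using e x by (intro Henstock_Kurzweil_Integration.integral_combine int\<theta>) auto
    moreover have "0 \<le> integral {R - x..R + x} \<theta>"
      by (intro Henstock_Kurzweil_Integration.integral_nonneg int\<theta>) (auto intro: nonneg)
    moreover have "integral {1 - x..1 + x} \<theta> \<le> 2 * x * \<theta> 0"
      using integral_le[OF int\<theta> integrable_const_ivl, of "1 - x" "1 + x" "\<theta> 0"] x
      by (simp add: anti)
    ultimately show ?thesis
      by linarith
  qed
  then show thesis
    by (intro that) (auto simp: \<phi>_def)
qed

text \<open>\<open>Lim\<close> carries information only once convergence is known. The truncations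
  converge to minus the supremum of the integrals of \<open>\<phi>\<close>, so any single integral
  gives an upper bound for the transform.\<close>

lemma hilbert_transform_le_integral:
  fixes \<theta> \<theta>' :: "real \<Rightarrow> real"
  assumes der: "\<And>x. (\<theta> has_real_derivative \<theta>' x) (at x)"
    and cont': "continuous_on UNIV \<theta>'"
    and anti: "\<And>a b. \<bar>a\<bar> \<le> \<bar>b\<bar> \<Longrightarrow> \<theta> b \<le> \<theta> a"
    and nonneg: "\<And>x. 0 \<le> \<theta> x"
    and x: "0 < x" and e: "0 < e"
  shows "hilbert_transform \<theta> x \<le> - (1 / pi) * integral {e..R} (\<lambda>t. (\<theta> (x - t) - \<theta> (x + t)) / t)"
proof -
  define \<phi> where "\<phi> = (\<lambda>t. (\<theta> (x - t) - \<theta> (x + t)) / t)"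
  have cont: "continuous_on UNIV \<theta>"
    using der by (meson DERIV_isCont continuous_at_imp_continuous_on)
  have int\<phi>: "\<phi> integrable_on {e..R}" if "0 < e" for e R
    unfolding \<phi>_def using that
    by (intro integrable_continuous_interval continuous_intros continuous_on_compose2[OF cont]) auto
  have \<phi>_nonneg: "0 \<le> \<phi> t" if "0 < t" for t
    unfolding \<phi>_def using x that by (intro divide_nonneg_pos) (auto intro!: anti)
  obtain B where "\<And>e R. 0 < e \<Longrightarrow> e < 1 \<Longrightarrow> 1 < R \<Longrightarrow> integral {e..R} \<phi> \<le> B"
    using truncated_hilbert_bounded[OF der cont' anti nonneg x] unfolding \<phi>_def by metis
  then obtain L where L: "((\<lambda>(e, R). integral {e..R} \<phi>) \<longlongrightarrow> L) (at_right 0 \<times>\<^sub>F at_top)"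
    and le_L: "\<And>e R. 0 < e \<Longrightarrow> integral {e..R} \<phi> \<le> L"
    using truncated_integral_tendsto[of \<phi>, OF int\<phi> \<phi>_nonneg] by metis
  let ?H = "\<lambda>(e, R). LINT y:{y. e < \<bar>y - x\<bar> \<and> \<bar>y - x\<bar> < R}|lebesgue. \<theta> y / (y - x)"
  \<comment> \<open>The folding identity requires \<open>e < R\<close>; the separate conditions
    \<open>e < 1\<close> and \<open>1 < R\<close> guarantee this in the product filter.\<close>
  have "\<forall>\<^sub>F p in at_right 0 \<times>\<^sub>F at_top. - (case p of (e, R) \<Rightarrow> integral {e..R} \<phi>) = ?H p"
    unfolding eventually_prod_filter
  proof (intro exI conjI allI impI)
    show "\<forall>\<^sub>F e::real in at_right 0. 0 < e \<and> e < 1"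
      by (auto simp: eventually_at_right_field intro: exI[of _ 1])
    show "\<forall>\<^sub>F R::real in at_top. 1 < R"
      by (rule eventually_gt_at_top)
    show "- (case (e, R) of (e, R) \<Rightarrow> integral {e..R} \<phi>) = ?H (e, R)"
      if "0 < e \<and> e < 1" "1 < R" for e R
      using truncated_hilbert_eq_integral[OF cont, of e R x] that by (simp add: \<phi>_def)
  qed
  then have "(?H \<longlongrightarrow> - L) (at_right 0 \<times>\<^sub>F at_top)"
    by (rule Lim_transform_eventually[OF tendsto_minus[OF L]])
  then have "Lim (at_right 0 \<times>\<^sub>F at_top) ?H = - L"
    by (intro tendsto_Lim) (simp add: prod_filter_eq_bot)
  then have "hilbert_transform \<theta> x = - (1 / pi) * L"
    by (simp add: hilbert_transform_def)
  also have "\<dots> \<le> - (1 / pi) * integral {e..R} \<phi>"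
    using le_L[OF e, of R] by (intro mult_left_mono_neg) auto
  finally show ?thesis
    by (simp add: \<phi>_def)
qed

section \<open>Bounding the transform by the drop of the function\<close>

text \<open>Only the window \<open>{h..2 * h}\<close> of the integral is kept. Its length
  \<open>h\<close> cancels against the weight \<open>1 / t \<ge> 1 / (2 * h)\<close>, so the bound
  depends on the drop alone.\<close>

lemma hilbert_transform_le_drop:
  fixes \<theta> \<theta>' :: "real \<Rightarrow> real"
  assumes der: "\<And>x. (\<theta> has_real_derivative \<theta>' x) (at x)"
    and cont': "continuous_on UNIV \<theta>'"
    and anti: "\<And>a b. \<bar>a\<bar> \<le> \<bar>b\<bar> \<Longrightarrow> \<theta> b \<le> \<theta> a"
    and nonneg: "\<And>x. 0 \<le> \<theta> x"
    and ord: "x1 < x" "x < x2" and far: "x2 - x1 \<le> x1"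
  shows "hilbert_transform \<theta> x \<le> - (\<theta> x1 - \<theta> x2) / (2 * pi)"
proof -
  define \<phi> where "\<phi> = (\<lambda>t. (\<theta> (x - t) - \<theta> (x + t)) / t)"
  define h where "h = x2 - x1"
  have h: "0 < h" "0 < x" "h \<le> x1"
    using ord far by (auto simp: h_def)
  have cont: "continuous_on UNIV \<theta>"
    using der by (meson DERIV_isCont continuous_at_imp_continuous_on)
  have d: "0 \<le> \<theta> x1 - \<theta> x2"
    using anti[of x1 x2] ord h by auto
  have "(\<theta> x1 - \<theta> x2) / 2 = integral {h..2 * h} (\<lambda>t. (\<theta> x1 - \<theta> x2) / (2 * h))"
    using h by simp
  also have "\<dots> \<le> integral {h..2 * h} \<phi>"
  proof (rule integral_le)
    show "\<phi> integrable_on {h..2 * h}"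
      unfolding \<phi>_def using h
      by (intro integrable_continuous_interval continuous_intros continuous_on_compose2[OF cont]) auto
    show "(\<theta> x1 - \<theta> x2) / (2 * h) \<le> \<phi> t" if t: "t \<in> {h..2 * h}" for t
    proof -
      \<comment> \<open>Here \<open>x - t < x2 - h = x1\<close> and, because
        \<open>h \<le> x1\<close>, also \<open>x - t > x1 - 2 * h \<ge> - x1\<close>; moreover
        \<open>x + t > x1 + h = x2\<close>.\<close>
      have "\<theta> x1 \<le> \<theta> (x - t)" "\<theta> (x + t) \<le> \<theta> x2"
        using t h ord by (auto intro!: anti simp: h_def)
      then show ?thesis
        unfolding \<phi>_def using t h d by (intro frac_le) auto
    qed
  qed (rule integrable_const_ivl)
  finally have "(\<theta> x1 - \<theta> x2) / 2 \<le> integral {h..2 * h} \<phi>" .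
  moreover have "hilbert_transform \<theta> x \<le> - (1 / pi) * integral {h..2 * h} \<phi>"
    unfolding \<phi>_def using h by (intro hilbert_transform_le_integral[OF der cont' anti nonneg]) auto
  moreover have "- (1 / pi) * integral {h..2 * h} \<phi> \<le> - (1 / pi) * ((\<theta> x1 - \<theta> x2) / 2)"
    using calculation(1) by (intro mult_left_mono_neg) auto
  ultimately have "hilbert_transform \<theta> x \<le> - (1 / pi) * ((\<theta> x1 - \<theta> x2) / 2)"
    by linarith
  then show ?thesis
    by (simp add: field_simps)
qed

section \<open>From almost-everywhere bounds to the estimate away from the origin\<close>

lemma AE_Linf_norm_bound:
  assumes "f \<in> Linf"
  shows "AE x in lebesgue. \<bar>f x\<bar> \<le> Linf_norm f" and "0 \<le> Linf_norm f"
proof -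
  define E where "E = esssup lebesgue (\<lambda>x. ereal \<bar>f x\<bar>)"
  have "E < \<infinity>"
    using assms by (simp add: Linf_def E_def)
  \<comment> \<open>Comparison with the zero function excludes the value minus infinity, so the
    conversion to a real number is exact.\<close>
  have "esssup lebesgue (\<lambda>x::real. (0::ereal)) \<le> E"
    unfolding E_def by (rule esssup_mono) auto
  then have "0 \<le> E"
    by (subst (asm) esssup_const) auto
  with \<open>E < \<infinity>\<close> have E: "E = ereal (Linf_norm f)"
    by (cases E) (auto simp: Linf_norm_def E_def)
  show "0 \<le> Linf_norm f"
    using \<open>0 \<le> E\<close> by (simp add: E)
  have "AE x in lebesgue. ereal \<bar>f x\<bar> \<le> E"
    unfolding E_def by (rule esssup_AE)
  then show "AE x in lebesgue. \<bar>f x\<bar> \<le> Linf_norm f"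
    by (simp add: E)
qed

text \<open>A violation at one point would, by continuity, persist on a nonempty open set, which is
  not negligible. This makes the slope bound available at the point chosen by the mean value
  theorem.\<close>

lemma AE_le_imp_le:
  fixes g :: "real \<Rightarrow> real"
  assumes ae: "AE x in lebesgue. x \<in> U \<longrightarrow> g x \<le> c"
    and U: "open U" and g: "continuous_on U g" and x: "x \<in> U"
  shows "g x \<le> c"
proof (rule ccontr)
  assume "\<not> g x \<le> c"
  define V where "V = U \<inter> g -` {c<..}"
  have "open V"
    unfolding V_def by (rule continuous_open_preimage[OF g U]) auto
  moreover have "V \<noteq> {}"
    using x \<open>\<not> g x \<le> c\<close> by (auto simp: V_def)
  moreover obtain N where "negligible N" "{x. \<not> (x \<in> U \<longrightarrow> g x \<le> c)} \<subseteq> N"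
    using ae by (auto simp: eventually_ae_filter_negligible)
  then have "negligible V"
    by (elim negligible_subset) (auto simp: V_def)
  ultimately show False
    using open_not_negligible by blast
qed

lemma drop_far_from_origin:
  fixes \<theta> \<theta>' :: "real \<Rightarrow> real"
  assumes der: "\<And>x. (\<theta> has_real_derivative \<theta>' x) (at x)"
    and cont': "continuous_on UNIV \<theta>'"
    and anti: "\<And>a b. \<bar>a\<bar> \<le> \<bar>b\<bar> \<Longrightarrow> \<theta> b \<le> \<theta> a"
    and nonneg: "\<And>x. 0 \<le> \<theta> x"
    and ae: "AE x in lebesgue. hilbert_transform \<theta> x * \<theta>' x \<le> M" and M: "0 \<le> M"
    and ord: "x1 < x2" and far: "x2 - x1 \<le> x1"
  shows "\<theta> x1 - \<theta> x2 \<le> sqrt (2 * pi * M) * sqrt (x2 - x1)"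
proof -
  define d where "d = \<theta> x1 - \<theta> x2"
  have d: "0 \<le> d"
    using anti[of x1 x2] ord far by (auto simp: d_def)
  \<comment> \<open>The transform is eliminated before leaving the almost-everywhere setting, since
    what remains is continuous in \<open>x\<close>. The product form avoids dividing by
    \<open>d\<close>, which may vanish.\<close>
  have "AE x in lebesgue. x \<in> {x1<..<x2} \<longrightarrow> - (d * \<theta>' x) \<le> 2 * pi * M"
    using ae
  proof eventually_elim
    case (elim x)
    show ?case
    proof
      assume x: "x \<in> {x1<..<x2}"
      show "- (d * \<theta>' x) \<le> 2 * pi * M"
      \<comment> \<open>A nonpositive slope reverses the upper bound on the transform, as required;
        for a positive slope the left side is already nonpositive.\<close>
      proof (cases "\<theta>' x \<le> 0")
        case True
        have "hilbert_transform \<theta> x \<le> - d / (2 * pi)"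
          using hilbert_transform_le_drop[OF der cont' anti nonneg _ _ far] x by (auto simp: d_def)
        then have "- d / (2 * pi) * \<theta>' x \<le> hilbert_transform \<theta> x * \<theta>' x"
          using True by (rule mult_right_mono_neg)
        then have "- d / (2 * pi) * \<theta>' x \<le> M"
          using elim by linarith
        then show ?thesis
          by (simp add: field_simps)
      next
        case False
        then have "0 \<le> d * \<theta>' x" "0 \<le> 2 * pi * M"
          using d M by auto
        then show ?thesis
          by linarith
      qed
    qed
  qed
  then have bound: "- (d * \<theta>' x) \<le> 2 * pi * M" if "x \<in> {x1<..<x2}" for x
    using that
    by (intro AE_le_imp_le[where g = "\<lambda>x. - (d * \<theta>' x)" and U = "{x1<..<x2}"]) (auto intro!: continuous_intros continuous_on_subset[OF cont'])
  have "\<exists>z. z > x1 \<and> z < x2 \<and> \<theta> x2 - \<theta> x1 = (x2 - x1) * \<theta>' z"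
    using ord by (intro MVT2 der) auto
  then obtain z where z: "z \<in> {x1<..<x2}" "d = (x2 - x1) * - \<theta>' z"
    by (auto simp: d_def)
  have "d\<^sup>2 = (x2 - x1) * - (d * \<theta>' z)"
    using z(2) by (simp add: power2_eq_square)
  also have "\<dots> \<le> (x2 - x1) * (2 * pi * M)"
    using bound[OF z(1)] ord by (intro mult_left_mono) auto
  finally have "d \<le> sqrt ((x2 - x1) * (2 * pi * M))"
    by (rule real_le_rsqrt)
  then show ?thesis
    by (simp only: d_def real_sqrt_mult mult.commute)
qed

section \<open>Dyadic descent to the origin\<close>

text \<open>Subtracting \<open>3 * K * sqrt s\<close> absorbs the error of each halving, so the
  difference \<open>E\<close> does not decrease along \<open>t / 2 ^ n\<close> and is bounded by its
  limit 0. The constant 3 rounds up the geometric sum \<open>1 / (sqrt 2 - 1)\<close>.\<close>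

lemma sqrt_bound_from_halving:
  fixes D :: "real \<Rightarrow> real"
  assumes half: "\<And>t. 0 < t \<Longrightarrow> D t \<le> D (t / 2) + K * sqrt (t / 2)"
    and lim: "(D \<longlongrightarrow> 0) (at 0)" and K: "0 \<le> K" and t: "0 < t"
  shows "D t \<le> 3 * K * sqrt t"
proof -
  define E where "E = (\<lambda>s. D s - 3 * K * sqrt s)"
  \<comment> \<open>Equivalent to \<open>1 \<le> 3 * (sqrt 2 - 1)\<close>, the condition for one
    halving to be absorbed.\<close>
  have "4 / 3 \<le> sqrt (2::real)"
    by (rule real_le_rsqrt) (simp add: power2_eq_square)
  have step: "E s \<le> E (s / 2)" if "0 < s" for s
  proof -
    have "4 * (K * sqrt (s / 2)) \<le> (3 * sqrt 2) * (K * sqrt (s / 2))"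
      using K that \<open>4 / 3 \<le> sqrt 2\<close> by (intro mult_right_mono) auto
    also have "\<dots> = 3 * K * sqrt s"
      using that by (simp add: real_sqrt_divide)
    finally show ?thesis
      using half[OF that] by (simp add: E_def)
  qed
  have iter: "E t \<le> E (t / 2 ^ n)" for n
  proof (induction n)
    case (Suc n)
    then show ?case
      using step[of "t / 2 ^ n"] t by (simp add: field_simps)
  qed simp
  have "(\<lambda>n. t / 2 ^ n) \<longlonglongrightarrow> 0"
    by (rule LIMSEQ_divide_realpow_zero) simp
  then have "filterlim (\<lambda>n. t / 2 ^ n) (at 0) sequentially"
    using t by (auto simp: filterlim_at)
  moreover have "(E \<longlongrightarrow> 0 - 3 * K * sqrt 0) (at 0)"
    unfolding E_def by (intro tendsto_intros lim)
  ultimately have "(\<lambda>n. E (t / 2 ^ n)) \<longlonglongrightarrow> 0"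
    using filterlim_compose by fastforce
  then have "E t \<le> 0"
    by (rule LIMSEQ_le_const) (use iter in auto)
  then show ?thesis
    by (simp add: E_def)
qed

text \<open>When the interval is long compared with its distance from the origin, its drop is at
  most the drop from 0 to \<open>x2\<close>, and \<open>x2 < 2 * (x2 - x1)\<close> keeps the scale
  comparable.\<close>

lemma hoelder_on_nonneg:
  fixes \<theta> \<theta>' :: "real \<Rightarrow> real"
  assumes der: "\<And>x. (\<theta> has_real_derivative \<theta>' x) (at x)"
    and cont': "continuous_on UNIV \<theta>'"
    and anti: "\<And>a b. \<bar>a\<bar> \<le> \<bar>b\<bar> \<Longrightarrow> \<theta> b \<le> \<theta> a"
    and nonneg: "\<And>x. 0 \<le> \<theta> x"
    and ae: "AE x in lebesgue. hilbert_transform \<theta> x * \<theta>' x \<le> M" and M: "0 \<le> M"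
    and ord: "0 \<le> x1" "x1 \<le> x2"
  shows "\<theta> x1 - \<theta> x2 \<le> 5 * sqrt (2 * pi * M) * sqrt (x2 - x1)"
proof -
  define K where "K = sqrt (2 * pi * M)"
  have K: "0 \<le> K"
    using M by (simp add: K_def)
  have far: "\<theta> a - \<theta> b \<le> K * sqrt (b - a)" if "a < b" "b - a \<le> a" for a b
    unfolding K_def using that by (intro drop_far_from_origin[OF der cont' anti nonneg ae M])
  consider "x1 = x2" | "x1 < x2" "x2 - x1 \<le> x1" | "x1 < x2 - x1"
    using ord by linarith
  then have "\<theta> x1 - \<theta> x2 \<le> 5 * K * sqrt (x2 - x1)"
  proof cases
    case 2
    have "\<theta> x1 - \<theta> x2 \<le> 1 * (K * sqrt (x2 - x1))"
      using far[OF 2] by simp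
    also have "\<dots> \<le> 5 * (K * sqrt (x2 - x1))"
      using K ord by (intro mult_right_mono) auto
    finally show ?thesis by simp
  next
    case 3
    have "\<theta> 0 - \<theta> x2 \<le> 3 * K * sqrt x2"
    proof (rule sqrt_bound_from_halving)
      \<comment> \<open>The interval from \<open>t / 2\<close> to \<open>t\<close> is the borderline
        case of \<open>far\<close>: its length equals its left endpoint.\<close>
      show "\<theta> 0 - \<theta> t \<le> \<theta> 0 - \<theta> (t / 2) + K * sqrt (t / 2)" if "0 < t" for t
        using far[of "t / 2" t] that by simp
      have "(\<theta> \<longlongrightarrow> \<theta> 0) (at 0)"
        using DERIV_isCont[OF der] by (simp add: isCont_def)
      then show "((\<lambda>t. \<theta> 0 - \<theta> t) \<longlongrightarrow> 0) (at 0)"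
        using tendsto_diff[OF tendsto_const, of \<theta> "\<theta> 0" "at 0" "\<theta> 0"] by simp
    qed (use K ord 3 in auto)
    moreover have "\<theta> x1 \<le> \<theta> 0"
      by (rule anti) simp
    \<comment> \<open>From \<open>x2 < 2 * (x2 - x1)\<close> the factor is
      \<open>3 * sqrt 2\<close>, rounded up to 5.\<close>
    moreover have "3 * sqrt x2 \<le> 5 * sqrt (x2 - x1)"
    proof -
      have "3 * sqrt x2 = sqrt (9 * x2)"
        by (simp add: real_sqrt_mult)
      also have "\<dots> \<le> sqrt (25 * (x2 - x1))"
        using 3 ord by simp
      also have "\<dots> = 5 * sqrt (x2 - x1)"
        by (simp only: real_sqrt_mult) simp
      finally show ?thesis .
    qed
    then have "K * (3 * sqrt x2) \<le> K * (5 * sqrt (x2 - x1))"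
      by (rule mult_left_mono[OF _ K])
    ultimately show ?thesis
      by (simp add: mult_ac)
  qed auto
  then show ?thesis
    by (simp add: K_def)
qed

section \<open>Passage to arbitrary pairs of points\<close>

text \<open>Monotonicity is given on the open half-line; continuity extends it to the origin and
  evenness to negative arguments. The result is the single comparison principle \<open>anti\<close>
  of the preceding lemmas.\<close>

lemma even_antimono_abs:
  fixes \<theta> :: "real \<Rightarrow> real"
  assumes cont: "continuous_on UNIV \<theta>" and even: "\<And>x. \<theta> (- x) = \<theta> x"
    and anti: "antimono_on {0<..} \<theta>" and le: "\<bar>a\<bar> \<le> \<bar>b\<bar>"
  shows "\<theta> b \<le> \<theta> a"
proof -
  have abs: "\<theta> \<bar>x\<bar> = \<theta> x" for x
    by (auto simp: abs_if even)
  have pos: "\<theta> v \<le> \<theta> u" if "0 < u" "u \<le> v" for u v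
    using monotone_onD[OF anti] that by auto
  have zero: "\<theta> v \<le> \<theta> 0" if "0 < v" for v
  proof (rule tendsto_lowerbound)
    show "(\<theta> \<longlongrightarrow> \<theta> 0) (at_right 0)"
      using cont by (meson UNIV_I continuous_on_def filterlim_mono at_le subset_UNIV order_refl)
    show "\<forall>\<^sub>F u in at_right 0. \<theta> v \<le> \<theta> u"
      using that by (auto simp: eventually_at_right_field intro!: exI[of _ v] pos)
  qed simp
  have "\<theta> \<bar>b\<bar> \<le> \<theta> \<bar>a\<bar>"
    using le pos[of "\<bar>a\<bar>" "\<bar>b\<bar>"] zero[of "\<bar>b\<bar>"] by (cases "a = 0"; cases "b = 0") auto
  then show ?thesis
    by (simp add: abs)
qed

theorem theorem7p3:
  "\<exists>C::real. C > 0 \<and>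
     (\<forall>(\<theta>::real \<Rightarrow> real) (f::real \<Rightarrow> real).
        f \<in> Linf \<longrightarrow>
        (AE x in lebesgue. 0 \<le> f x) \<longrightarrow>
        stationary_solution \<theta> f \<longrightarrow>
        (\<forall>x. \<theta> (- x) = \<theta> x) \<longrightarrow>
        antimono_on {0<..} \<theta> \<longrightarrow>
        (\<forall>x. 0 \<le> \<theta> x) \<longrightarrow>
        (\<forall>x1 x2. x1 \<noteq> x2 \<longrightarrow>
           \<bar>\<theta> x1 - \<theta> x2\<bar> \<le> C * Linf_norm f powr (1 / 2) * \<bar>x1 - x2\<bar> powr (1 / 2)))"
proof (intro exI[of _ "5 * sqrt (2 * pi)"] conjI allI impI)
  fix \<theta> f :: "real \<Rightarrow> real" and x1 x2 :: real
  assume f: "f \<in> Linf" and sol: "stationary_solution \<theta> f"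
    and even: "\<forall>x. \<theta> (- x) = \<theta> x" and mono: "antimono_on {0<..} \<theta>"
    and nonneg: "\<forall>x. 0 \<le> \<theta> x"
  obtain \<theta>' where der': "\<And>x. (\<theta> has_vector_derivative \<theta>' x) (at x)"
    and cont': "continuous_on UNIV \<theta>'"
    using sol by (auto simp: stationary_solution_def C1_differentiable_on_def)
  have der: "(\<theta> has_real_derivative \<theta>' x) (at x)" for x
    using der' by (simp add: has_real_derivative_iff_has_vector_derivative)
  have "continuous_on UNIV \<theta>"
    using der by (meson DERIV_isCont continuous_at_imp_continuous_on)
  then have anti: "\<theta> b \<le> \<theta> a" if "\<bar>a\<bar> \<le> \<bar>b\<bar>" for a b
    using even_antimono_abs[of \<theta>] even mono that by blast
  define M where "M = Linf_norm f"
  have M: "0 \<le> M"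
    using AE_Linf_norm_bound(2)[OF f] by (simp add: M_def)
  have "AE x in lebesgue. \<bar>f x\<bar> \<le> M"
    using AE_Linf_norm_bound(1)[OF f] by (simp add: M_def)
  moreover have "AE x in lebesgue. hilbert_transform \<theta> x * \<theta>' x = f x"
    using sol DERIV_imp_deriv[OF der] by (simp add: stationary_solution_def)
  ultimately have ae: "AE x in lebesgue. hilbert_transform \<theta> x * \<theta>' x \<le> M"
    by eventually_elim auto
  have ordered: "\<bar>\<theta> a - \<theta> b\<bar> \<le> 5 * sqrt (2 * pi) * M powr (1 / 2) * \<bar>a - b\<bar> powr (1 / 2)"
    if le: "\<bar>a\<bar> \<le> \<bar>b\<bar>" for a b
  proof -
    have abs: "\<theta> \<bar>x\<bar> = \<theta> x" for x
      by (auto simp: abs_if even)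
    have "\<bar>\<theta> a - \<theta> b\<bar> = \<theta> \<bar>a\<bar> - \<theta> \<bar>b\<bar>"
      using anti[OF le] by (simp add: abs)
    also have "\<dots> \<le> 5 * sqrt (2 * pi * M) * sqrt (\<bar>b\<bar> - \<bar>a\<bar>)"
      using nonneg le by (intro hoelder_on_nonneg[OF der cont' anti _ ae M]) auto
    \<comment> \<open>The reverse triangle inequality: passing to absolute values does not increase
      the distance.\<close>
    also have "\<dots> \<le> 5 * sqrt (2 * pi * M) * sqrt \<bar>a - b\<bar>"
      using M by (intro mult_left_mono) auto
    also have "\<dots> = 5 * sqrt (2 * pi) * M powr (1 / 2) * \<bar>a - b\<bar> powr (1 / 2)"
      using M by (simp add: real_sqrt_mult powr_half_sqrt)
    finally show ?thesis .
  qed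
  show "\<bar>\<theta> x1 - \<theta> x2\<bar> \<le> 5 * sqrt (2 * pi) * Linf_norm f powr (1 / 2) * \<bar>x1 - x2\<bar> powr (1 / 2)"
    using ordered[of x1 x2] ordered[of x2 x1]
    by (cases "\<bar>x1\<bar> \<le> \<bar>x2\<bar>") (auto simp: M_def abs_minus_commute)
qed simp

end
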